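(* Suppose $W$ is a $\triangle$-coregular tournamenton, that is, the function $$\triangle_W(x,y)=\frac{W(x,y)\,p_W(x,y)+W(y,x)\,p_W(y,x)}2$$ is constant almost everywhere on $[0,1]^2$. Then $W$ is weakly equivalent to the Condorcet tournamenton $W_p$ for some $p\in[\frac12,1]$.
   Context: A tournamenton is a measurable function $W:[0,1]^2\to[0,1]$ with $W(x,y)+W(y,x)=1$ for all $x,y\in[0,1]$. Here $p_W(x,y)=\int_0^1W(y,z)W(z,x)\,\mathrm dz$. For $p\in[0,1]$ the Condorcet tournamenton is $W_p(x,y)=p$ if $x<y$, $1-p$ if $x>y$, and $\frac12$ if $x=y$. Two tournamentons $W,\tilde W$ are weakly equivalent if there exist measure preserving maps $\psi,\phi:[0,1]\to[0,1]$ (Lebesgue measure) such that $W(\psi(x),\psi(y))=\tilde W(\phi(x),\phi(y))$ for almost every $(x,y)$. *)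

theory Defs
  imports "HOL-Analysis.Analysis"
begin

abbreviation unit_ivl :: "real set" where
  "unit_ivl \<equiv> {0..1}"

text \<open>
  Functions on the unit square are represented by curried functions on all of \<open>real\<close>;
  only their values on \<open>unit_ivl\<close> are ever used. ``Measurable'' means Lebesgue measurable
  (so Borel measurable functions are included).
\<close>

definition tournamenton :: "(real \<Rightarrow> real \<Rightarrow> real) \<Rightarrow> bool" where
  "tournamenton W \<longleftrightarrow>
     case_prod W \<in> borel_measurable (lebesgue_on (unit_ivl \<times> unit_ivl)) \<and>
     (\<forall>x\<in>unit_ivl. \<forall>y\<in>unit_ivl. W x y \<in> {0..1}) \<and>
     (\<forall>x\<in>unit_ivl. \<forall>y\<in>unit_ivl. W x y + W y x = 1)"

text \<open>
  For a Lebesgue measurable \<open>W\<close> the integrand below is measurable for almost every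
  \<open>(x, y)\<close>; on the exceptional null set the integral has the default value \<open>0\<close>.
\<close>

definition return_density :: "(real \<Rightarrow> real \<Rightarrow> real) \<Rightarrow> real \<Rightarrow> real \<Rightarrow> real" where
  "return_density W x y = (LINT z|lebesgue_on unit_ivl. W y z * W z x)"

definition triangle_codegree :: "(real \<Rightarrow> real \<Rightarrow> real) \<Rightarrow> real \<Rightarrow> real \<Rightarrow> real" where
  "triangle_codegree W x y =
     (W x y * return_density W x y + W y x * return_density W y x) / 2"

definition triangle_coregular :: "(real \<Rightarrow> real \<Rightarrow> real) \<Rightarrow> bool" where
  "triangle_coregular W \<longleftrightarrow>
     (\<exists>c. AE (x, y) in lebesgue_on (unit_ivl \<times> unit_ivl). triangle_codegree W x y = c)"

definition condorcet :: "real \<Rightarrow> real \<Rightarrow> real \<Rightarrow> real" where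
  "condorcet p x y = (if x < y then p else if x > y then 1 - p else 1 / 2)"

definition measure_preserving :: "'a measure \<Rightarrow> 'b measure \<Rightarrow> ('a \<Rightarrow> 'b) \<Rightarrow> bool" where
  "measure_preserving M N f \<longleftrightarrow>
     f \<in> measurable M N \<and> (\<forall>A\<in>sets N. emeasure M (f -` A \<inter> space M) = emeasure N A)"

definition weakly_equivalent ::
  "(real \<Rightarrow> real \<Rightarrow> real) \<Rightarrow> (real \<Rightarrow> real \<Rightarrow> real) \<Rightarrow> bool" where
  "weakly_equivalent W W' \<longleftrightarrow>
     (\<exists>\<psi> \<phi>. measure_preserving (lebesgue_on unit_ivl) (lebesgue_on unit_ivl) \<psi> \<and>
            measure_preserving (lebesgue_on unit_ivl) (lebesgue_on unit_ivl) \<phi> \<and>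
            (AE (x, y) in lebesgue_on (unit_ivl \<times> unit_ivl).
               W (\<psi> x) (\<psi> y) = W' (\<phi> x) (\<phi> y)))"

lemma tournamenton_condorcet:
  assumes "0 \<le> p" "p \<le> 1"
  shows "tournamenton (condorcet p)"
proof -
  have "case_prod (condorcet p) \<in> borel_measurable (borel :: (real \<times> real) measure)"
    unfolding condorcet_def borel_prod [symmetric] by measurable
  then have "case_prod (condorcet p) \<in> borel_measurable (lebesgue_on (unit_ivl \<times> unit_ivl))"
    by (intro measurable_restrict_space1 measurable_completion) simp
  with assms show ?thesis
    by (auto simp: tournamenton_def condorcet_def)
qed

end

theory Submission
  imports Defs "HOL-Probability.Probability"
begin

text \<open>
  Put \<open>K = W - 1/2\<close>, an antisymmetric kernel, and let \<open>d x = \<integral>z. K x z\<close> be the (centred) score of \<open>x\<close>.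
  Expanding the definition of \<open>triangle_codegree\<close> shows that \<open>W\<close> is coregular exactly if, for some
  constant \<open>c\<close> and almost all \<open>x, y\<close>, the relation
  \<open>(\<integral>z. K x z * K y z) + K x y * (d x - d y) = c\<close> holds, where \<open>c\<close> is \<open>1/4\<close> minus twice the value of
  \<open>triangle_codegree\<close>. In operator form, with \<open>D\<close> the multiplication by \<open>d\<close> and \<open>J\<close> the integration
  against \<open>1\<close>, this says \<open>K\<^sup>2 = [D, K] - c J\<close>. Integration, viewed as an operator on functions of one
  variable, satisfies a relation of this form, and the point is that \<open>K\<close> must act on functions of the
  score as integration does, up to constants.

  Indeed, applying the relation to \<open>d\<^sup>n\<close> gives by induction that \<open>(n + 1) K d\<^sup>n\<close> is \<open>d\<^sup>n\<^sup>+\<^sup>1\<close> minus a constant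
  (\<open>score_power_image\<close>). Integrating this identity yields a recursion for the moments of \<open>d\<close>
  (\<open>score_moment_rec\<close>), whose solution is the moment sequence of the uniform distribution on
  \<open>[-r, r]\<close> with \<open>r = sqrt c\<close>; as bounded distributions are determined by their moments, \<open>d\<close> is uniform
  there (\<open>score_uniform\<close>). The same identity then says that \<open>K\<close> and the kernel
  \<open>S x y = r * sgn (d x - d y)\<close> have the same integrals against functions of the score.

  It remains to see that \<open>K\<close> has no part beyond \<open>S\<close>. The residual \<open>R = K - S\<close> is orthogonal to functions
  of the score (\<open>residual_orthogonal\<close>), and since \<open>S\<close> satisfies the relation as well, subtracting leaves
  \<open>R\<^sup>2 = [D, R]\<close> (\<open>residual_equation\<close>). Hence the trace of \<open>R\<^sup>2 R\<^sup>2 = R\<^sup>2 [D, R]\<close> is a combination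
  of integrals of \<open>d\<close> against the diagonal of the antisymmetric kernel \<open>R\<^sup>3\<close>, which vanishes
  (\<open>residual_cube_diagonal\<close>). So \<open>R\<^sup>2 = 0\<close>, and \<open>R = 0\<close> because \<open>R\<^sup>2 = - R R\<^sup>T\<close>. Therefore
  \<open>W x y = 1/2 + r * sgn (d x - d y)\<close> almost everywhere, and the relative position of the score in
  \<open>[-r, r]\<close>, counted from above, is a measure preserving map that carries \<open>W\<close> to the Condorcet
  tournamenton with \<open>p = 1/2 + r\<close>; here \<open>r \<le> 1/2\<close> because \<open>d\<close> is bounded by \<open>1/2\<close>. If \<open>c = 0\<close>, then \<open>d = 0\<close>
  and \<open>S = 0\<close>, the same argument gives \<open>K = R = 0\<close>, and \<open>W\<close> is constant.
\<close>

section \<open>Bounded functions and uniform distributions\<close>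

lemma integrable_bounded_by:
  assumes "f \<in> borel_measurable N" "finite_measure N" "\<And>x. \<bar>f x\<bar> \<le> (C::real)"
  shows "integrable N f"
  using assms by (auto intro: finite_measure.integrable_const_bound[where B=C])

lemma abs_mult_le: "\<bar>a\<bar> \<le> C \<Longrightarrow> \<bar>b\<bar> \<le> D \<Longrightarrow> \<bar>a * b\<bar> \<le> C * (D::real)"
  by (simp add: abs_mult mult_mono')

lemma abs_mult_le_1: "\<bar>a\<bar> \<le> 1 \<Longrightarrow> \<bar>b\<bar> \<le> 1 \<Longrightarrow> \<bar>a * b\<bar> \<le> (1::real)"
  by (simp add: abs_mult mult_le_one)

lemma abs_sgn_le_1: "\<bar>sgn x\<bar> \<le> (1::real)"
  by (simp add: sgn_if)

lemma integral_uniform_measure_interval: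
  fixes f :: "real \<Rightarrow> real"
  assumes "a < b" and f [measurable]: "f \<in> borel_measurable borel"
  shows "(\<integral>t. f t \<partial>uniform_measure lborel {a..b}) = (\<integral>t. f t * indicator {a..b} t \<partial>lborel) / (b - a)"
proof -
  have "uniform_measure lborel {a..b} = density lborel (\<lambda>t. ennreal (indicator {a..b} t / (b - a)))"
    unfolding uniform_measure_def using assms
    by (intro density_cong) (auto simp: indicator_def divide_ennreal[symmetric])
  then have "(\<integral>t. f t \<partial>uniform_measure lborel {a..b})
      = (\<integral>t. (indicator {a..b} t / (b - a)) *\<^sub>R f t \<partial>lborel)"
    using assms by (simp only:) (rule integral_density, auto)
  also have "\<dots> = (\<integral>t. f t * indicator {a..b} t / (b - a) \<partial>lborel)"
    by (simp add: mult.commute)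
  finally show ?thesis by simp
qed

lemma integrable_power_indicator: "integrable lborel (\<lambda>t::real. t ^ n * indicator {a..b} t)"
  using borel_integrable_atLeastAtMost[of a b "\<lambda>t. t ^ n"] by (simp add: mult.commute)

text \<open>
  The next two integrals describe the model kernel: \<open>sgn (s - t)\<close> on an interval integrates powers up
  to a constant, and its Gram kernel is an affine function of the distance.
\<close>

lemma integral_sgn_power_uniform:
  fixes s :: real
  assumes "a < b" "a \<le> s" "s \<le> b"
  shows "(\<integral>t. sgn (s - t) * t ^ n \<partial>uniform_measure lborel {a..b})
    = (2 * s ^ (n + 1) - a ^ (n + 1) - b ^ (n + 1)) / ((b - a) * (real n + 1))"
proof -
  have "(\<integral>t. sgn (s - t) * t ^ n * indicator {a..b} t \<partial>lborel)
      = (\<integral>t. t ^ n * indicator {a..s} t - t ^ n * indicator {s..b} t \<partial>lborel)"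
    using assms by (intro Bochner_Integration.integral_cong) (auto simp: indicator_def sgn_if)
  also have "\<dots> = (s ^ Suc n - a ^ Suc n) / Suc n - (b ^ Suc n - s ^ Suc n) / Suc n"
    using assms by (subst Bochner_Integration.integral_diff)
      (auto simp: integral_power integrable_power_indicator simp del: power_Suc)
  also have "\<dots> = (2 * s ^ (n + 1) - a ^ (n + 1) - b ^ (n + 1)) / (real n + 1)"
    by (simp add: diff_divide_distrib[symmetric] add.commute)
  finally show ?thesis using assms
    by (subst integral_uniform_measure_interval) (auto simp: mult.commute)
qed

lemma integral_sgn_sgn_uniform:
  fixes s u :: real
  assumes "a < b" "s \<in> {a..b}" "u \<in> {a..b}"
  shows "(\<integral>t. sgn (s - t) * sgn (u - t) \<partial>uniform_measure lborel {a..b})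
    = 1 - 2 * \<bar>s - u\<bar> / (b - a)"
proof -
  have "(\<integral>t. sgn (s - t) * sgn (u - t) * indicator {a..b} t \<partial>lborel)
      = (\<integral>t. t ^ 0 * indicator {a..b} t - 2 * (t ^ 0 * indicator {min s u..max s u} t) \<partial>lborel)"
    using AE_lborel_singleton[of s] AE_lborel_singleton[of u] assms
    by (intro integral_cong_AE) (auto simp: indicator_def sgn_if)
  also have "\<dots> = (b - a) - 2 * (max s u - min s u)"
  proof -
    have "(\<integral>t. t ^ 0 * indicator {p..q} t \<partial>lborel) = q - p" if "p \<le> q" for p q :: real
      using integral_power[OF that, of 0] by simp
    moreover have "integrable lborel (\<lambda>t. t ^ 0 * indicator {p..q} t :: real)" for p q :: real
      by (rule integrable_power_indicator)
    ultimately show ?thesis using assms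
      by (subst Bochner_Integration.integral_diff) (simp_all del: power_0)
  qed
  also have "max s u - min s u = \<bar>s - u\<bar>" by auto
  finally show ?thesis using assms
    by (subst integral_uniform_measure_interval) (auto simp: field_simps)
qed

lemma integral_power_uniform:
  fixes a :: real
  assumes "a < b"
  shows "(\<integral>t. t ^ n \<partial>uniform_measure lborel {a..b})
    = (b ^ (n + 1) - a ^ (n + 1)) / ((b - a) * (real n + 1))"
  using assms by (subst integral_uniform_measure_interval)
    (auto simp: integral_power mult.commute add.commute)

section \<open>Moments of bounded random variables\<close>

text \<open>
  Polynomials approximate \<open>f\<close> uniformly on \<open>{-B..B}\<close>, and integrating against \<open>h\<close> or \<open>g\<close> is continuous
  for uniform convergence. The weights \<open>h\<close> and \<open>g\<close> may change sign, so that the result applies both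
  to distributions and to rows of a signed kernel.
\<close>

lemma integral_eq_of_moments_eq_continuous:
  fixes X :: "'a \<Rightarrow> real" and Y :: "'b \<Rightarrow> real" and f :: "real \<Rightarrow> real"
  assumes h: "integrable M h" and g: "integrable N g"
    and X [measurable]: "X \<in> borel_measurable M" and Y [measurable]: "Y \<in> borel_measurable N"
    and XB: "AE x in M. X x \<in> {-B..B}" and YB: "AE y in N. Y y \<in> {-B..B}"
    and moments: "\<And>n. (\<integral>x. h x * X x ^ n \<partial>M) = (\<integral>y. g y * Y y ^ n \<partial>N)"
    and f: "continuous_on UNIV f"
  shows "(\<integral>x. h x * f (X x) \<partial>M) = (\<integral>y. g y * f (Y y) \<partial>N)"
proof -
  note [measurable] = borel_measurable_integrable[OF h] borel_measurable_integrable[OF g]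
  have fm: "u \<in> borel_measurable borel" if "continuous_on UNIV u" for u :: "real \<Rightarrow> real"
    using that by (rule borel_measurable_continuous_onI)
  have int: "integrable L (\<lambda>x. k x * u (Z x))" and
    int_le: "\<bar>\<integral>x. k x * u (Z x) \<partial>L\<bar> \<le> C * (\<integral>x. \<bar>k x\<bar> \<partial>L)"
    if "integrable L k" "Z \<in> borel_measurable L" "AE x in L. Z x \<in> {-B..B}"
      "continuous_on UNIV u" "\<forall>t\<in>{-B..B}. \<bar>u t\<bar> \<le> C"
    for L :: "'c measure" and k Z and u :: "real \<Rightarrow> real" and C
  proof -
    note [measurable] = that(2) borel_measurable_integrable[OF that(1)] fm[OF that(4)]
    have ae: "AE x in L. norm (k x * u (Z x)) \<le> norm (C * \<bar>k x\<bar>)"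
      using that(3)
    proof eventually_elim
      case (elim x)
      then have "\<bar>u (Z x)\<bar> \<le> C" using that(5) by blast
      then show ?case by (auto simp: abs_mult mult.commute[of C] intro!: mult_left_mono)
    qed
    show i: "integrable L (\<lambda>x. k x * u (Z x))"
      by (rule Bochner_Integration.integrable_bound[OF _ _ ae]) (use that(1) in auto)
    have "\<bar>\<integral>x. k x * u (Z x) \<partial>L\<bar> \<le> (\<integral>x. \<bar>k x * u (Z x)\<bar> \<partial>L)"
      by (rule integral_abs_bound)
    also have "\<dots> \<le> (\<integral>x. C * \<bar>k x\<bar> \<partial>L)"
    proof (rule integral_mono_AE)
      show "AE x in L. \<bar>k x * u (Z x)\<bar> \<le> C * \<bar>k x\<bar>"
        using that(3)
      proof eventually_elim
        case (elim x)
        then have "\<bar>u (Z x)\<bar> \<le> C" using that(5) by blast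
        then show ?case by (auto simp: abs_mult mult.commute[of C] intro!: mult_left_mono)
      qed
    qed (use that(1) i in auto)
    finally show "\<bar>\<integral>x. k x * u (Z x) \<partial>L\<bar> \<le> C * (\<integral>x. \<bar>k x\<bar> \<partial>L)" by simp
  qed
  have intM: "integrable M (\<lambda>x. h x * u (X x))" and intN: "integrable N (\<lambda>x. g x * u (Y x))"
    if u: "continuous_on UNIV u" for u
  proof -
    have "compact (u ` {-B..B})"
      by (intro compact_continuous_image continuous_on_subset[OF u]) auto
    then obtain C where "\<forall>t\<in>{-B..B}. \<bar>u t\<bar> \<le> C"
      using compact_imp_bounded by (force simp: bounded_iff)
    then show "integrable M (\<lambda>x. h x * u (X x))" "integrable N (\<lambda>x. g x * u (Y x))"
      using int[OF h X XB u] int[OF g Y YB u] by auto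
  qed
  have poly: "(\<integral>x. h x * q (X x) \<partial>M) = (\<integral>y. g y * q (Y y) \<partial>N)"
    if pq: "real_polynomial_function q" for q
  proof -
    obtain a n where q: "q = (\<lambda>x. \<Sum>i\<le>n. a i * x ^ i)"
      using pq unfolding real_polynomial_function_iff_sum by blast
    have "(\<integral>x. h x * q (X x) \<partial>M) = (\<Sum>i\<le>n. a i * (\<integral>x. h x * X x ^ i \<partial>M))"
      unfolding q sum_distrib_left
      by (subst Bochner_Integration.integral_sum)
         (auto simp: mult.left_commute intro!: intM continuous_intros)
    moreover have "(\<integral>x. g x * q (Y x) \<partial>N) = (\<Sum>i\<le>n. a i * (\<integral>x. g x * Y x ^ i \<partial>N))"
      unfolding q sum_distrib_left
      by (subst Bochner_Integration.integral_sum)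
         (auto simp: mult.left_commute intro!: intN continuous_intros)
    ultimately show ?thesis by (simp add: moments)
  qed
  \<comment> \<open>An approximation error below \<open>e'\<close> costs at most \<open>e' * ?I\<close>; the summand 1 in \<open>e'\<close> avoids
    a division by 0.\<close>
  let ?I = "(\<integral>x. \<bar>h x\<bar> \<partial>M) + (\<integral>y. \<bar>g y\<bar> \<partial>N)"
  have I0: "0 \<le> ?I" by (intro add_nonneg_nonneg integral_nonneg) auto
  have "\<bar>(\<integral>x. h x * f (X x) \<partial>M) - (\<integral>y. g y * f (Y y) \<partial>N)\<bar> \<le> e" if "0 < e" for e
  proof -
    define e' where "e' = e / (?I + 1)"
    have e': "0 < e'" unfolding e'_def using that I0 by (intro divide_pos_pos) linarith+
    obtain q where q: "real_polynomial_function q" "\<And>t. t \<in> {-B..B} \<Longrightarrow> \<bar>f t - q t\<bar> < e'"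
      using Stone_Weierstrass_real_polynomial_function[of "{-B..B}" f e'] e' f
        continuous_on_subset by blast
    have qc: "continuous_on UNIV q"
      using q(1) continuous_on_polymonial_function by (metis real_polynomial_function_eq)
    have c: "continuous_on UNIV (\<lambda>t. f t - q t)" by (intro continuous_intros f qc)
    have *: "\<forall>t\<in>{-B..B}. \<bar>f t - q t\<bar> \<le> e'" using q(2) less_imp_le by blast
    have "(\<integral>x. h x * (f (X x) - q (X x)) \<partial>M)
        = (\<integral>x. h x * f (X x) \<partial>M) - (\<integral>x. h x * q (X x) \<partial>M)"
      unfolding right_diff_distrib by (intro Bochner_Integration.integral_diff intM f qc)
    moreover have "(\<integral>x. g x * (f (Y x) - q (Y x)) \<partial>N)
        = (\<integral>x. g x * f (Y x) \<partial>N) - (\<integral>x. g x * q (Y x) \<partial>N)"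
      unfolding right_diff_distrib by (intro Bochner_Integration.integral_diff intN f qc)
    ultimately have "\<bar>(\<integral>x. h x * f (X x) \<partial>M) - (\<integral>y. g y * f (Y y) \<partial>N)\<bar> \<le> e' * ?I"
      using int_le[OF h X XB c *] int_le[OF g Y YB c *] poly[OF q(1)]
      by (simp add: distrib_left)
    also have "\<dots> \<le> e"
    proof -
      have "0 < ?I + 1" using I0 by linarith
      then show ?thesis
        unfolding e'_def using that mult_left_mono[of ?I "?I + 1" e]
        by (simp add: pos_divide_le_eq)
    qed
    finally show ?thesis .
  qed
  then have "\<bar>(\<integral>x. h x * f (X x) \<partial>M) - (\<integral>y. g y * f (Y y) \<partial>N)\<bar> \<le> 0"
    by (rule field_le_epsilon) simp
  then show ?thesis by simp
qed

text \<open>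
  Bounded pointwise limits of continuous functions suffice below: they include \<open>sgn\<close> and the
  indicators of half-lines.
\<close>

lemma integral_eq_of_moments_eq:
  fixes X :: "'a \<Rightarrow> real" and Y :: "'b \<Rightarrow> real" and f :: "real \<Rightarrow> real"
  assumes h: "integrable M h" and g: "integrable N g"
    and X [measurable]: "X \<in> borel_measurable M" and Y [measurable]: "Y \<in> borel_measurable N"
    and XB: "AE x in M. X x \<in> {-B..B}" and YB: "AE y in N. Y y \<in> {-B..B}"
    and moments: "\<And>n. (\<integral>x. h x * X x ^ n \<partial>M) = (\<integral>y. g y * Y y ^ n \<partial>N)"
    and F: "\<And>k::nat. continuous_on UNIV (F k)" and FC: "\<And>k t. \<bar>F k t\<bar> \<le> C"
    and lim: "\<And>t. (\<lambda>k. F k t) \<longlonglongrightarrow> f t"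
  shows "(\<integral>x. h x * f (X x) \<partial>M) = (\<integral>y. g y * f (Y y) \<partial>N)"
proof -
  have Fm [measurable]: "F k \<in> borel_measurable borel" for k
    by (rule borel_measurable_continuous_onI[OF F])
  have fm [measurable]: "f \<in> borel_measurable borel"
    by (rule borel_measurable_LIMSEQ_real[OF lim]) simp
  have conv: "(\<lambda>k. \<integral>x. k' x * F k (Z x) \<partial>L) \<longlonglongrightarrow> (\<integral>x. k' x * f (Z x) \<partial>L)"
    if "integrable L k'" "Z \<in> borel_measurable L" for L :: "'c measure" and k' Z
  proof -
    note [measurable] = that(2) borel_measurable_integrable[OF that(1)]
    show ?thesis
    proof (rule integral_dominated_convergence[where w = "\<lambda>x. C * \<bar>k' x\<bar>"])
      show "AE x in L. (\<lambda>k. k' x * F k (Z x)) \<longlonglongrightarrow> k' x * f (Z x)"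
        by (intro AE_I2 tendsto_intros lim)
      show "AE x in L. norm (k' x * F k (Z x)) \<le> C * \<bar>k' x\<bar>" for k
        using FC[of k] by (auto simp: abs_mult mult.commute[of C] intro!: mult_left_mono)
    qed (use that in auto)
  qed
  have "(\<lambda>k. \<integral>x. h x * F k (X x) \<partial>M) \<longlonglongrightarrow> (\<integral>y. g y * f (Y y) \<partial>N)"
    using conv[OF g Y] integral_eq_of_moments_eq_continuous[OF h g X Y XB YB moments F] by simp
  with conv[OF h X] show ?thesis by (rule LIMSEQ_unique)
qed

text \<open>Applied to positive parts of \<open>s - t\<close> or \<open>t - s\<close>, this builds the approximations of step functions.\<close>

lemma LIMSEQ_min_mult:
  fixes u :: real assumes "0 \<le> u"
  shows "(\<lambda>k. min 1 (real k * u)) \<longlonglongrightarrow> (if u = 0 then 0 else 1)"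
proof (cases "u = 0")
  case False
  then obtain n where n: "1 / u < real n" using reals_Archimedean2 by blast
  have "eventually (\<lambda>k. min 1 (real k * u) = 1) sequentially"
    using eventually_ge_at_top[of n]
  proof eventually_elim
    case (elim k)
    have "1 < real n * u" using n False assms by (simp add: field_simps)
    also have "\<dots> \<le> real k * u" using elim assms by (intro mult_right_mono) auto
    finally show ?case by simp
  qed
  then show ?thesis using False by (simp add: tendsto_eventually)
qed simp

lemma distr_eq_of_moments_eq:
  fixes X :: "'a \<Rightarrow> real"
  assumes "prob_space M" "real_distribution N"
    and X [measurable]: "X \<in> borel_measurable M"
    and XB: "AE x in M. X x \<in> {-B..B}" and NB: "AE t in N. t \<in> {-B..B}"
    and moments: "\<And>n. (\<integral>x. X x ^ n \<partial>M) = (\<integral>t. t ^ n \<partial>N)"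
  shows "distr M borel X = N"
proof (rule cdf_unique)
  interpret M: prob_space M by fact
  interpret N: real_distribution N by fact
  show "real_distribution (distr M borel X)" by (rule M.real_distribution_distr) simp
  show "real_distribution N" by fact
  show "cdf (distr M borel X) = cdf N"
  proof
    fix s
    have "(\<integral>x. 1 * indicator {..s} (X x) \<partial>M) = (\<integral>t. 1 * indicator {..s} t \<partial>N :: real)"
    proof (rule integral_eq_of_moments_eq[where f = "indicator {..s}" and C = 1
          and h = "\<lambda>_. 1" and g = "\<lambda>_. 1" and Y = "\<lambda>t. t"
          and F = "\<lambda>k t. 1 - min 1 (real k * max 0 (t - s))", OF _ _ X _ XB NB])
      show "continuous_on UNIV (\<lambda>t. 1 - min 1 (real k * max 0 (t - s)))" for k
        by (intro continuous_intros)
      show "\<bar>1 - min 1 (real k * max 0 (t - s))\<bar> \<le> 1" for k t by auto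
      show "(\<lambda>k. 1 - min 1 (real k * max 0 (t - s))) \<longlonglongrightarrow> indicator {..s} t" for t
        using tendsto_diff[OF tendsto_const LIMSEQ_min_mult[of "max 0 (t - s)"], of 1]
        by (auto simp: indicator_def max_def split: if_splits)
    qed (use moments in auto)
    moreover have "measure (distr M borel X) {..s} = (\<integral>t. indicator {..s} t \<partial>distr M borel X)"
      by simp
    moreover have "\<dots> = (\<integral>x. indicator {..s} (X x) \<partial>M)"
      by (rule integral_distr) auto
    ultimately show "cdf (distr M borel X) s = cdf N s"
      by (simp add: cdf_def)
  qed
qed

section \<open>Vanishing on all rectangles\<close>

text \<open>
  The sets over which \<open>f\<close> integrates to 0 form a Dynkin system, and rectangles are an intersection
  stable generator of the product algebra.
\<close>

lemma (in pair_prob_space) AE_eq_0_if_rectangle_integrals_0: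
  fixes f :: "'a \<times> 'b \<Rightarrow> real"
  assumes f: "integrable (M1 \<Otimes>\<^sub>M M2) f"
    and rect: "\<And>A B. A \<in> sets M1 \<Longrightarrow> B \<in> sets M2 \<Longrightarrow>
      (\<integral>x. indicator A x * (\<integral>y. indicator B y * f (x, y) \<partial>M2) \<partial>M1) = 0"
  shows "AE z in M1 \<Otimes>\<^sub>M M2. f z = 0"
proof (rule density_unique_real[OF f])
  note [measurable] = borel_measurable_integrable[OF f]
  let ?P = "M1 \<Otimes>\<^sub>M M2"
  have int: "integrable ?P (\<lambda>z. indicator E z * f z)" if "E \<in> sets ?P" for E
    using integrable_mult_indicator[OF that f] by simp
  have prod: "(\<integral>z. indicator (A \<times> B) z * f z \<partial>?P) = 0"
    if [measurable]: "A \<in> sets M1" "B \<in> sets M2" for A B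
  proof -
    have "(\<integral>z. indicator (A \<times> B) z * f z \<partial>?P)
        = (\<integral>x. \<integral>y. indicator (A \<times> B) (x, y) * f (x, y) \<partial>M2 \<partial>M1)"
      by (rule integral_fst'[symmetric, OF int]) simp
    also have "\<dots> = (\<integral>x. indicator A x * (\<integral>y. indicator B y * f (x, y) \<partial>M2) \<partial>M1)"
      by (simp add: indicator_times mult.assoc)
    finally show ?thesis using rect[OF that] by simp
  qed
  have "(\<integral>z. indicator E z * f z \<partial>?P) = 0" if "E \<in> sets ?P" for E
    using Int_stable_pair_measure_generator pair_measure_closed that
    unfolding sets_pair_measure
  proof (induct rule: sigma_sets_induct_disjoint)
    case (basic E)
    then show ?case using prod by auto
  next
    case empty
    then show ?case by simp
  next
    case (compl E)
    then have E: "E \<in> sets ?P" by (simp add: sets_pair_measure)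
    have "(\<integral>z. indicator (space M1 \<times> space M2 - E) z * f z \<partial>?P)
        = (\<integral>z. indicator (space M1 \<times> space M2) z * f z - indicator E z * f z \<partial>?P)"
      using sets.sets_into_space[OF E]
      by (intro Bochner_Integration.integral_cong) (auto simp: space_pair_measure indicator_def)
    also have "\<dots> = 0"
      using compl(2) prod[OF sets.top sets.top] E
      by (subst Bochner_Integration.integral_diff) (auto intro!: int)
    finally show ?case .
  next
    case (union F)
    then have F: "F i \<in> sets ?P" for i by (auto simp: sets_pair_measure)
    then have "(\<integral>z\<in>(\<Union>i. F i). f z \<partial>?P) = (\<Sum>i. \<integral>z\<in>F i. f z \<partial>?P)"
      using union(1) int[of "\<Union>i. F i"]
      by (intro lebesgue_integral_countable_add)
         (auto simp: set_integrable_def disjoint_family_on_def)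
    then show ?case using union(3)
      by (simp add: set_lebesgue_integral_def)
  qed
  then show "(\<integral>z\<in>E. f z \<partial>?P) = (\<integral>z\<in>E. 0 \<partial>?P)" if "E \<in> sets ?P" for E
    using that by (simp add: set_lebesgue_integral_def)
qed simp

section \<open>The score distribution of a coregular kernel\<close>

text \<open>
  The relation for \<open>K = W - 1/2\<close> from the introduction, on an arbitrary probability space. Antisymmetry
  and the bound hold at every point, so that no integral below has to avoid exceptional points for their sake.
\<close>

locale coregular_kernel = prob_space M
  for M :: "'a measure" +
  fixes K :: "'a \<Rightarrow> 'a \<Rightarrow> real" and c :: real
  assumes measurable_kernel [measurable]: "case_prod K \<in> borel_measurable (M \<Otimes>\<^sub>M M)"
    and antisym: "K x y = - K y x"
    and kernel_le_half: "\<bar>K x y\<bar> \<le> 1 / 2"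
    and coregular: "AE x in M. AE y in M.
      (\<integral>z. K x z * K y z \<partial>M) + K x y * ((\<integral>z. K x z \<partial>M) - (\<integral>z. K y z \<partial>M)) = c"
begin

sublocale square: pair_prob_space M M ..

definition score :: "'a \<Rightarrow> real" where
  "score x = (\<integral>z. K x z \<partial>M)"

definition score_moment :: "nat \<Rightarrow> real" where
  "score_moment n = (\<integral>x. score x ^ n \<partial>M)"

lemma measurable_kernel_compose [measurable (raw)]:
  "f \<in> measurable N M \<Longrightarrow> g \<in> measurable N M \<Longrightarrow> (\<lambda>w. K (f w) (g w)) \<in> borel_measurable N"
  using measurable_compose[OF measurable_Pair[of f N M g M] measurable_kernel] by simp

lemma measurable_score [measurable]: "score \<in> borel_measurable M"
  unfolding score_def by measurable

lemma abs_integral_le: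
  assumes "\<And>y. \<bar>f y\<bar> \<le> (C::real)"
  shows "\<bar>\<integral>y. f y \<partial>M\<bar> \<le> C"
proof (cases "integrable M f")
  case True
  have "\<bar>\<integral>y. f y \<partial>M\<bar> \<le> (\<integral>y. \<bar>f y\<bar> \<partial>M)" by (rule integral_abs_bound)
  also have "\<dots> \<le> (\<integral>y. C \<partial>M)"
    using True by (intro integral_mono assms) auto
  finally show ?thesis by (simp add: prob_space)
next
  case False
  then show ?thesis using order_trans[OF abs_ge_zero assms] by (simp add: not_integrable_integral_eq)
qed

lemma score_le_half: "\<bar>score x\<bar> \<le> 1 / 2"
  unfolding score_def by (intro abs_integral_le kernel_le_half)

lemma score_power_le: "\<bar>score x ^ n\<bar> \<le> 1"
  using score_le_half[of x] by (simp add: power_abs power_le_one)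

lemma kernel_le_1: "\<bar>K x y\<bar> \<le> 1" using kernel_le_half[of x y] by linarith

lemma score_diff_le_1: "\<bar>score x - score y\<bar> \<le> 1"
  using score_le_half[of x] score_le_half[of y] by linarith

lemma fubini_swap:
  assumes [measurable]: "case_prod f \<in> borel_measurable (M \<Otimes>\<^sub>M M)"
    and "\<And>x y. \<bar>f x y\<bar> \<le> (C::real)"
  shows "(\<integral>x. (\<integral>y. f x y \<partial>M) \<partial>M) = (\<integral>y. (\<integral>x. f x y \<partial>M) \<partial>M)"
  by (rule square.Fubini_integral[symmetric])
     (rule integrable_bounded_by[where C=C], use assms in \<open>auto simp: square.P.finite_measure_axioms\<close>)

text \<open>
  The core of the argument. Write \<open>K f\<close> for \<open>\<lambda>x. \<integral>y. K x y * f y\<close>. Multiplying the coregularity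
  relation by \<open>score y ^ n\<close> and integrating over \<open>y\<close> turns it into
  \<open>- K (K d\<^sup>n) + d * K d\<^sup>n - K d\<^sup>n\<^sup>+\<^sup>1 = c * m\<^sub>n\<close> with \<open>d\<close> the score and \<open>m\<^sub>n\<close> its moments. If \<open>K d\<^sup>n\<close> is
  known to be \<open>d\<^sup>n\<^sup>+\<^sup>1 / (n + 1)\<close> up to a constant, this can be solved for \<open>K d\<^sup>n\<^sup>+\<^sup>1\<close>, with a result of the
  same form. Its constant involves \<open>m\<^sub>n\<close>, but antisymmetry of \<open>K\<close> also expresses it by the integral of
  \<open>K d\<^sup>n\<^sup>+\<^sup>1\<close>, which is \<open>- m\<^sub>n\<^sub>+\<^sub>2\<close>; comparing both gives the recursion of the moments. The two
  claims are proved together because each step of the induction uses both.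
\<close>

lemma score_power_image:
  "AE x in M. (real n + 1) * (\<integral>y. K x y * score y ^ n \<partial>M)
     = score x ^ (n + 1) - (real n + 2) * score_moment (n + 1)"
  (is "?P n") and
  score_moment_rec: "(real n + 3) * score_moment (n + 2) = c * (real n + 1) * score_moment n"
  (is "?Q n")
proof -
  have int: "(\<integral>x. \<integral>y. K x y * score y ^ n \<partial>M \<partial>M) = - score_moment (n + 1)" for n
  proof -
    have "(\<integral>x. \<integral>y. K x y * score y ^ n \<partial>M \<partial>M) = (\<integral>y. \<integral>x. K x y * score y ^ n \<partial>M \<partial>M)"
      by (rule fubini_swap[where C=1]) (auto intro!: abs_mult_le_1 kernel_le_1 score_power_le)
    also have "\<dots> = (\<integral>y. - (score y ^ (n + 1)) \<partial>M)"
    proof (rule Bochner_Integration.integral_cong[OF refl])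
      fix y
      have "(\<integral>x. K x y * score y ^ n \<partial>M) = (\<integral>x. - (K y x * score y ^ n) \<partial>M)"
        by (rule Bochner_Integration.integral_cong[OF refl]) (simp add: antisym[of _ y])
      then show "(\<integral>x. K x y * score y ^ n \<partial>M) = - (score y ^ (n + 1))"
        by (simp add: score_def)
    qed
    finally show ?thesis by (simp add: score_moment_def)
  qed
  have cor: "AE x in M. AE y in M. (\<integral>z. K x z * K y z \<partial>M) + K x y * (score x - score y) = c"
    using coregular by (simp add: score_def)
  have PQ: "?P (Suc n) \<and> ?Q n" if "?P n" for n
  proof -
    have *: "AE x in M. (real n + 2) * (\<integral>y. K x y * score y ^ (n + 1) \<partial>M)
        = score x ^ (n + 2) - c * (real n + 1) * score_moment n"
      using cor that AE_space
    proof eventually_elim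
      case (elim x)
      have [simp]: "integrable M (\<lambda>y. K x y * score y ^ m)" for m
        using elim(3) by (intro integrable_bounded_by[where C=1])
          (auto intro!: abs_mult_le_1 kernel_le_1 score_power_le finite_measure_axioms)
      have [simp]: "integrable M (K x)"
        using elim(3) by (intro integrable_bounded_by[where C=1])
          (auto intro!: kernel_le_1 finite_measure_axioms)
      have [simp]: "integrable M (\<lambda>y. score y ^ m)" for m
        by (intro integrable_bounded_by[where C=1])
          (auto intro!: abs_mult_le_1 kernel_le_1 score_power_le finite_measure_axioms)
      have "(\<integral>y. (\<integral>z. K x z * K y z \<partial>M) * score y ^ n \<partial>M)
          = (\<integral>y. \<integral>z. K x z * K y z * score y ^ n \<partial>M \<partial>M)" by simp
      also have "\<dots> = (\<integral>z. \<integral>y. K x z * K y z * score y ^ n \<partial>M \<partial>M)"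
        using elim(3)
        by (intro fubini_swap[where C=1]) (auto intro!: abs_mult_le_1 kernel_le_1 score_power_le)
      also have "\<dots> = (\<integral>z. K x z * (- (\<integral>y. K z y * score y ^ n \<partial>M)) \<partial>M)"
      proof (rule Bochner_Integration.integral_cong[OF refl])
        fix z
        have "(\<integral>y. K x z * K y z * score y ^ n \<partial>M) = (\<integral>y. K x z * - (K z y * score y ^ n) \<partial>M)"
          by (rule Bochner_Integration.integral_cong[OF refl]) (simp add: antisym[of _ z])
        then show "(\<integral>y. K x z * K y z * score y ^ n \<partial>M) = K x z * - (\<integral>y. K z y * score y ^ n \<partial>M)"
          by simp
      qed
      also have "\<dots> = (\<integral>z. K x z * (((real n + 2) * score_moment (n + 1) - score z ^ (n + 1)) / (real n + 1)) \<partial>M)"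
      proof (rule integral_cong_AE)
        show "AE z in M. K x z * (- (\<integral>y. K z y * score y ^ n \<partial>M))
          = K x z * (((real n + 2) * score_moment (n + 1) - score z ^ (n + 1)) / (real n + 1))"
          using that
        proof eventually_elim
          case (elim z)
          then have "- (\<integral>y. K z y * score y ^ n \<partial>M)
              = ((real n + 2) * score_moment (n + 1) - score z ^ (n + 1)) / (real n + 1)"
            by (simp add: eq_divide_eq algebra_simps)
          then show ?case by (rule arg_cong)
        qed
      qed (use elim(3) in auto)
      also have "\<dots> = ((real n + 2) * score_moment (n + 1) * score x - (\<integral>z. K x z * score z ^ (n + 1) \<partial>M)) / (real n + 1)"
      proof -
        have "(\<integral>z. K x z * ((C - score z ^ (n + 1)) / (real n + 1)) \<partial>M)
            = (\<integral>z. (C * K x z - K x z * score z ^ (n + 1)) / (real n + 1) \<partial>M)" for C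
          by (simp add: algebra_simps)
        also have "\<dots> C = (C * score x - (\<integral>z. K x z * score z ^ (n + 1) \<partial>M)) / (real n + 1)" for C
          unfolding integral_divide_zero
          by (subst Bochner_Integration.integral_diff) (auto simp del: power_Suc simp: score_def[symmetric])
        finally show ?thesis .
      qed
      finally have 1: "(\<integral>y. (\<integral>z. K x z * K y z \<partial>M) * score y ^ n \<partial>M) = \<dots>" .
      have "(\<integral>y. (K x y * (score x - score y)) * score y ^ n \<partial>M) =
         (\<integral>y. score x * (K x y * score y ^ n) - K x y * score y ^ (n + 1) \<partial>M)"
        by (simp add: algebra_simps)
      also have "\<dots> = score x * (\<integral>y. K x y * score y ^ n \<partial>M) - (\<integral>y. K x y * score y ^ (n + 1) \<partial>M)"
        by (subst Bochner_Integration.integral_diff) (auto simp del: power_Suc)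
      finally have 2: "(\<integral>y. (K x y * (score x - score y)) * score y ^ n \<partial>M) = \<dots>" .
      have "c * score_moment n = (\<integral>y. c * score y ^ n \<partial>M)" by (simp add: score_moment_def)
      also have "\<dots> = (\<integral>y. ((\<integral>z. K x z * K y z \<partial>M) + K x y * (score x - score y)) * score y ^ n \<partial>M)"
        using elim(1,3) by (intro integral_cong_AE) auto
      also have "\<dots> = (\<integral>y. (\<integral>z. K x z * K y z \<partial>M) * score y ^ n \<partial>M) +
         (\<integral>y. (K x y * (score x - score y)) * score y ^ n \<partial>M)"
        unfolding distrib_right using elim(3)
        by (intro Bochner_Integration.integral_add integrable_bounded_by[where C=1])
           (auto intro!: abs_mult_le_1 abs_integral_le kernel_le_1 score_power_le score_diff_le_1
              finite_measure_axioms)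
      finally have "c * score_moment n * (real n + 1) = (real n + 2) * score_moment (n + 1) * score x
          - (\<integral>z. K x z * score z ^ (n + 1) \<partial>M)
          + score x * ((real n + 1) * (\<integral>y. K x y * score y ^ n \<partial>M))
          - (real n + 1) * (\<integral>y. K x y * score y ^ (n + 1) \<partial>M)"
        unfolding 1 2 by (simp add: field_simps)
      then show ?case unfolding elim(2) by (simp add: algebra_simps)
    qed
    have "(\<integral>x. (real n + 2) * (\<integral>y. K x y * score y ^ (n + 1) \<partial>M) \<partial>M)
       = (\<integral>x. score x ^ (n + 2) - c * (real n + 1) * score_moment n \<partial>M)"
      using * by (intro integral_cong_AE) auto
    also have "\<dots> = score_moment (n + 2) - c * (real n + 1) * score_moment n"
      by (subst Bochner_Integration.integral_diff)
         (auto simp: score_moment_def prob_space simp del: power_Suc intro!: integrable_bounded_by[where C=1]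
            score_power_le finite_measure_axioms)
    finally have rec: "?Q n"
      unfolding integral_mult_right_zero int[of "n + 1"] by (simp add: algebra_simps)
    moreover have "?P (Suc n)"
    proof -
      have "(real (Suc n) + 2) * score_moment (Suc n + 1) = c * (real n + 1) * score_moment n"
        using rec by (simp add: add.commute add.left_commute)
      moreover have "real (Suc n) + 1 = real n + 2" by simp
      ultimately show ?thesis using * by (simp add: add.commute)
    qed
    ultimately show ?thesis by blast
  qed
  have "?P n" for n
  proof (induction n)
    case 0
    have "score_moment 1 = - score_moment 1" using int[of 0]
      by (simp add: score_moment_def score_def)
    then show ?case by (simp add: score_def score_moment_def)
  next
    case (Suc n)
    with PQ show ?case by blast
  qed
  then show "?P n" "?Q n" using PQ by blast+
qed

text \<open>The scores will turn out to fill the interval of this radius around 0.\<close>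

definition radius :: real where "radius = sqrt c"

lemma score_moment_0: "score_moment 0 = 1"
  by (simp add: score_moment_def prob_space)

lemma score_moment_1: "score_moment 1 = 0"
proof -
  have "AE x in M. score_moment 1 = 0"
    using score_power_image[of 0] by (simp add: score_def[symmetric])
  then show ?thesis by simp
qed

text \<open>The variance of the score is \<open>c / 3\<close>.\<close>

lemma c_nonneg: "0 \<le> c"
proof -
  have "c = 3 * score_moment 2"
    using score_moment_rec[of 0] by (simp add: score_moment_0 numeral_2_eq_2)
  moreover have "0 \<le> score_moment 2" by (simp add: score_moment_def)
  ultimately show ?thesis by simp
qed

lemma score_moment_eq:
  assumes "0 < c"
  shows "score_moment n = (radius ^ (n + 1) - (- radius) ^ (n + 1)) / (2 * radius * (real n + 1))"
proof -
  have r: "0 < radius" "radius * radius = c" using assms by (auto simp: radius_def)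
  show ?thesis
  proof (induction n rule: induct_nat_012)
    case 0 then show ?case using r by (simp add: score_moment_0)
  next
    case 1 then show ?case using score_moment_1 by simp
  next
    case (ge2 n)
    have "score_moment (Suc (Suc n)) = radius * radius * (real n + 1) / (real n + 3) * score_moment n"
      using score_moment_rec[of n] r by (simp add: field_simps)
    also have "\<dots> = (radius ^ (Suc (Suc n) + 1) - (- radius) ^ (Suc (Suc n) + 1)) / (2 * radius * (real (Suc (Suc n)) + 1))"
      unfolding ge2(1) using r(1) by (simp add: divide_simps) (simp add: algebra_simps)
    finally show ?case .
  qed
qed

lemma score_uniform:
  assumes "0 < c"
  shows "distr M borel score = uniform_measure lborel {- radius..radius}"
proof -
  have r: "0 < radius" using assms by (auto simp: radius_def)
  define B where "B = max 1 radius"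
  show ?thesis
  proof (rule distr_eq_of_moments_eq[where B = B])
    have "prob_space (uniform_measure lborel {- radius..radius})"
      using r by (intro prob_space_uniform_measure) auto
    then show "real_distribution (uniform_measure lborel {- radius..radius})"
      by (auto simp: real_distribution_def real_distribution_axioms_def)
    show "AE x in M. score x \<in> {- B..B}"
      using score_le_half by (intro AE_I2) (auto simp: B_def abs_le_iff field_simps max_def; smt)
    show "AE t in uniform_measure lborel {- radius..radius}. t \<in> {- B..B}"
      by (rule AE_uniform_measureI) (auto simp: B_def)
    show "(\<integral>x. score x ^ n \<partial>M) = (\<integral>t. t ^ n \<partial>uniform_measure lborel {- radius..radius})" for n
      using score_moment_eq[OF assms, of n] r
      by (subst integral_power_uniform) (auto simp: score_moment_def)
  qed (auto simp: prob_space_axioms)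
qed

lemma expectation_score:
  assumes "0 < c" "f \<in> borel_measurable borel"
  shows "(\<integral>x. f (score x) \<partial>M) = (\<integral>t. f t \<partial>uniform_measure lborel {- radius..radius} :: real)"
  using assms by (simp add: score_uniform[symmetric] integral_distr)

lemma AE_score_le_radius: "AE x in M. score x \<in> {- radius..radius}"
proof (cases "c = 0")
  case True
  then have "score_moment 2 = 0"
    using score_moment_rec[of 0] by (simp add: numeral_2_eq_2)
  then have "AE x in M. (score x)\<^sup>2 = 0"
    unfolding score_moment_def
    by (subst integral_nonneg_eq_0_iff_AE[symmetric])
       (auto intro!: integrable_bounded_by[where C=1] score_power_le finite_measure_axioms)
  moreover have "radius = 0" unfolding radius_def using True by simp
  ultimately show ?thesis by simp
next
  case False
  then have "AE t in distr M borel score. t \<in> {- radius..radius}"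
    using c_nonneg unfolding score_uniform[OF False[THEN not_sym, THEN le_neq_trans[OF c_nonneg]]]
    by (intro AE_uniform_measureI) auto
  then show ?thesis by (subst (asm) AE_distr_iff) auto
qed

section \<open>The residual of a coregular kernel\<close>

text \<open>The difference of \<open>K\<close> to the sign kernel that it is going to equal; see \<open>kernel_eq_sgn\<close>.\<close>

definition residual :: "'a \<Rightarrow> 'a \<Rightarrow> real" where
  "residual x y = K x y - radius * sgn (score x - score y)"

lemma radius_nonneg: "0 \<le> radius" and radius_sq: "radius * radius = c"
  using c_nonneg by (auto simp: radius_def)

lemma measurable_residual [measurable (raw)]:
  assumes [measurable]: "f \<in> measurable N M" "g \<in> measurable N M"
  shows "(\<lambda>w. residual (f w) (g w)) \<in> borel_measurable N"
  unfolding residual_def by measurable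

lemma residual_antisym: "residual x y = - residual y x"
  unfolding residual_def antisym[of x y] by (simp add: sgn_if)

lemma residual_le: "\<bar>residual x y\<bar> \<le> 1 + radius"
  unfolding residual_def using kernel_le_1[of x y] radius_nonneg by (auto simp: sgn_if)

lemma score_le_1: "\<bar>score x\<bar> \<le> 1"
  using score_le_half[of x] by linarith

text \<open>
  By \<open>score_power_image\<close>, both parts of the residual have the same moments against the score. There
  are only countably many moments, so a single exceptional null set of points \<open>x\<close> serves all \<open>s\<close>.
\<close>

lemma residual_orthogonal:
  assumes "0 < c"
  shows "AE x in M. \<forall>s. (\<integral>y. residual x y * sgn (s - score y) \<partial>M) = 0"
proof -
  have r: "0 < radius" using assms by (simp add: radius_def)
  have "AE x in M. \<forall>n. (real n + 1) * (\<integral>y. K x y * score y ^ n \<partial>M)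
     = score x ^ (n + 1) - (real n + 2) * score_moment (n + 1)"
    using score_power_image by (simp add: AE_all_countable)
  then show ?thesis
    using AE_score_le_radius AE_space
  proof eventually_elim
    case (elim x)
    have moments: "(\<integral>y. residual x y * score y ^ n \<partial>M) = (\<integral>y. 0 * score y ^ n \<partial>M)" for n
    proof -
      have "(\<integral>y. sgn (score x - score y) * score y ^ n \<partial>M)
          = (2 * score x ^ (n + 1) - (- radius) ^ (n + 1) - radius ^ (n + 1)) / (2 * radius * (real n + 1))"
        using integral_sgn_power_uniform[of "- radius" radius "score x" n] r elim(2)
        by (subst expectation_score[OF assms, where f = "\<lambda>t. sgn (score x - t) * t ^ n"]) auto
      moreover have "(\<integral>y. K x y * score y ^ n \<partial>M)
          = (2 * score x ^ (n + 1) - (- radius) ^ (n + 1) - radius ^ (n + 1)) / (2 * (real n + 1))"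
      proof -
        have "(real n + 2) * score_moment (n + 1) = (radius ^ (n + 1) + (- radius) ^ (n + 1)) / 2"
          unfolding score_moment_eq[OF assms] using r by (simp add: divide_simps) (simp add: algebra_simps)
        then have "(real n + 1) * (\<integral>y. K x y * score y ^ n \<partial>M)
          = (2 * score x ^ (n + 1) - (- radius) ^ (n + 1) - radius ^ (n + 1)) / 2"
          using elim(1)[rule_format, of n] by (simp add: field_simps)
        then show ?thesis by (simp add: field_simps)
      qed
      moreover have "(\<integral>y. residual x y * score y ^ n \<partial>M)
          = (\<integral>y. K x y * score y ^ n - radius * (sgn (score x - score y) * score y ^ n) \<partial>M)"
        by (simp add: residual_def algebra_simps)
      moreover have "\<dots> = (\<integral>y. K x y * score y ^ n \<partial>M)
           - radius * (\<integral>y. sgn (score x - score y) * score y ^ n \<partial>M)"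
        using elim(3)
        by (subst Bochner_Integration.integral_diff)
           (auto intro!: integrable_bounded_by[where C=1] abs_mult_le_1 kernel_le_1 score_power_le
             abs_sgn_le_1 finite_measure_axioms)
      ultimately show ?thesis using r by simp
    qed
    show ?case
    proof
      fix s
      have "(\<integral>y. residual x y * sgn (s - score y) \<partial>M) = (\<integral>y. 0 * sgn (s - score y) \<partial>M)"
      proof (rule integral_eq_of_moments_eq[where B = 1 and C = 1 and f = "\<lambda>t. sgn (s - t)" and
          F = "\<lambda>k t. min 1 (real k * max 0 (s - t)) - min 1 (real k * max 0 (t - s))"])
        show "integrable M (residual x)"
          using elim(3)
          by (intro integrable_bounded_by[where C = "1 + radius"] residual_le finite_measure_axioms) measurable
        show "AE x in M. score x \<in> {- 1..1}" "AE x in M. score x \<in> {- 1..1}"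
          using score_power_le[of _ 1] by (auto simp: abs_le_iff minus_le_iff)
        show "continuous_on UNIV (\<lambda>t. min 1 (real k * max 0 (s - t)) - min 1 (real k * max 0 (t - s)))" for k
          by (intro continuous_intros)
        show "\<bar>min 1 (real k * max 0 (s - t)) - min 1 (real k * max 0 (t - s))\<bar> \<le> 1" for k t
          by (auto simp: max_def)
        show "(\<lambda>k. min 1 (real k * max 0 (s - t)) - min 1 (real k * max 0 (t - s))) \<longlonglongrightarrow> sgn (s - t)" for t
          using tendsto_diff[OF LIMSEQ_min_mult[of "max 0 (s - t)"] LIMSEQ_min_mult[of "max 0 (t - s)"]]
          by (auto simp: sgn_if max_def split: if_splits)
      qed (use moments in auto)
      then show "(\<integral>y. residual x y * sgn (s - score y) \<partial>M) = 0" by simp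
    qed
  qed
qed

text \<open>
  Expand the Gram kernel of \<open>R = K - S\<close> with \<open>S\<close> the sign kernel. The mixed integrals of \<open>R\<close> with \<open>S\<close>
  vanish by orthogonality, so it is the Gram kernel of \<open>K\<close> minus that of \<open>S\<close>; both are known, and the
  constant \<open>c\<close> cancels. For \<open>c = 0\<close> there is no sign part and the relation is the original one.
\<close>

lemma residual_equation:
  "AE x in M. AE y in M. (\<integral>z. residual x z * residual y z \<partial>M) = - residual x y * (score x - score y)"
proof (cases "c = 0")
  case True
  have [simp]: "radius = 0" unfolding radius_def using True by simp
  have [simp]: "residual = K" by (simp add: residual_def fun_eq_iff)
  have "AE x in M. AE y in M. (\<integral>z. K x z * K y z \<partial>M) + K x y * (score x - score y) = c"
    using coregular by (simp add: score_def)
  then show ?thesis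
    unfolding \<open>residual = K\<close>
    by eventually_elim (use True in \<open>simp add: eq_neg_iff_add_eq_0\<close>)
next
  case False
  then have c: "0 < c" using c_nonneg by simp
  then have r: "0 < radius" by (simp add: radius_def)
  have cor: "AE x in M. AE y in M. (\<integral>z. K x z * K y z \<partial>M) + K x y * (score x - score y) = c"
    using coregular by (simp add: score_def)
  show ?thesis
    using cor residual_orthogonal[OF c] AE_score_le_radius AE_space
  proof eventually_elim
    case x: (elim x)
    show ?case
      using x(1) residual_orthogonal[OF c] AE_score_le_radius AE_space
    proof eventually_elim
      case y: (elim y)
      have [simp]: "integrable M (\<lambda>z. residual w z * K w' z)"
          "integrable M (\<lambda>z. residual w z * sgn (score w' - score z))"
          "integrable M (\<lambda>z. sgn (score w - score z) * sgn (score w' - score z))"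
          "integrable M (\<lambda>z. K w z * K w' z)"
        if "w \<in> space M" "w' \<in> space M" for w w'
        using that
        by (intro integrable_bounded_by[where C="(1 + radius) * (1 + radius)"] abs_mult_le;
            use radius_nonneg kernel_le_1 residual_le abs_sgn_le_1 finite_measure_axioms in
              \<open>force intro: order_trans[OF _ add_increasing2[OF radius_nonneg order_refl]]\<close>)+
      have "(\<integral>z. residual x z * residual y z \<partial>M)
          = (\<integral>z. residual x z * K y z - radius * (residual x z * sgn (score y - score z)) \<partial>M)"
        by (simp add: residual_def[of y] algebra_simps)
      also have "\<dots> = (\<integral>z. residual x z * K y z \<partial>M)"
        using x y by (subst Bochner_Integration.integral_diff) auto
      also have "\<dots> = (\<integral>z. K x z * K y z - (radius * (residual y z * sgn (score x - score z))
          + radius * radius * (sgn (score x - score z) * sgn (score y - score z))) \<partial>M)"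
        by (simp add: residual_def algebra_simps)
      also have "\<dots> = (\<integral>z. K x z * K y z \<partial>M)
          - c * (\<integral>z. sgn (score x - score z) * sgn (score y - score z) \<partial>M)"
        using x y by (subst Bochner_Integration.integral_diff; simp add: radius_sq)
      also have "(\<integral>z. sgn (score x - score z) * sgn (score y - score z) \<partial>M)
          = 1 - 2 * \<bar>score x - score y\<bar> / (2 * radius)"
        using integral_sgn_sgn_uniform[of "- radius" radius "score x" "score y"] r x(3) y(3)
        by (subst expectation_score[OF c, where f = "\<lambda>t. sgn (score x - t) * sgn (score y - t)"]) auto
      also have "c * \<dots> = c - radius * \<bar>score x - score y\<bar>"
      proof -
        have "radius * radius * (1 - 2 * d / (2 * radius)) = radius * radius - radius * d" for d
          using r by (simp add: field_simps)
        then show ?thesis unfolding radius_sq .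
      qed
      finally have "(\<integral>z. residual x z * residual y z \<partial>M)
          = - K x y * (score x - score y) + radius * \<bar>score x - score y\<bar>"
        using y(1) by simp
      also have "\<dots> = - residual x y * (score x - score y)"
        unfolding residual_def abs_sgn[of "score x - score y"] by (simp add: algebra_simps)
      finally show ?case .
    qed
  qed
qed

text \<open>The kernel of \<open>R R\<^sup>T = - R\<^sup>2\<close>, where \<open>R\<close> is the integral operator of the residual.\<close>

definition residual_gram :: "'a \<Rightarrow> 'a \<Rightarrow> real" where
  "residual_gram x y = (\<integral>z. residual x z * residual y z \<partial>M)"

lemma measurable_residual_gram [measurable (raw)]:
  assumes [measurable]: "f \<in> measurable N M" "g \<in> measurable N M"
  shows "(\<lambda>w. residual_gram (f w) (g w)) \<in> borel_measurable N"
  unfolding residual_gram_def by measurable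

lemma residual_gram_le: "\<bar>residual_gram x y\<bar> \<le> (1 + radius) * (1 + radius)"
  unfolding residual_gram_def by (intro abs_integral_le abs_mult_le residual_le)

lemma residual_gram_sym: "residual_gram x y = residual_gram y x"
  unfolding residual_gram_def by (simp add: mult.commute)

text \<open>
  Up to sign this is the diagonal of the kernel of \<open>R\<^sup>3\<close>, which is antisymmetric; exchanging the two
  integration variables changes the sign of the integral.
\<close>

lemma residual_cube_diagonal:
  assumes [measurable]: "x \<in> space M"
  shows "(\<integral>y. residual_gram x y * residual x y \<partial>M) = 0"
proof -
  have "(\<integral>y. residual_gram x y * residual x y \<partial>M)
      = (\<integral>y. \<integral>z. residual x z * residual y z * residual x y \<partial>M \<partial>M)"
    by (simp add: residual_gram_def)
  also have "\<dots> = (\<integral>z. \<integral>y. residual x z * residual y z * residual x y \<partial>M \<partial>M)"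
    by (rule fubini_swap[where C = "(1 + radius) * (1 + radius) * (1 + radius)"])
       (auto intro!: abs_mult_le residual_le)
  also have "\<dots> = (\<integral>z. \<integral>y. - (residual x y * residual z y * residual x z) \<partial>M \<partial>M)"
    by (intro Bochner_Integration.integral_cong refl) (subst residual_antisym, simp)
  also have "\<dots> = - (\<integral>y. residual_gram x y * residual x y \<partial>M)"
    by (simp add: residual_gram_def)
  finally show ?thesis by simp
qed

text \<open>
  Replace one factor of the squared Gram kernel \<open>G\<close> by \<open>- R x y * (score x - score y)\<close>. Both resulting
  integrals have the form of an integral of the score against \<open>residual_cube_diagonal\<close>, the second
  one after exchanging \<open>x\<close> and \<open>y\<close>, so the integral of \<open>G\<^sup>2\<close> is 0.
\<close>

lemma residual_gram_eq_0: "AE z in M \<Otimes>\<^sub>M M. (case z of (x, y) \<Rightarrow> (residual_gram x y)\<^sup>2) = 0"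
proof -
  let ?G = residual_gram and ?R = residual
  have bound: "\<bar>(?G x y)\<^sup>2\<bar> \<le> ((1 + radius) * (1 + radius)) * ((1 + radius) * (1 + radius))" for x y
    unfolding power2_eq_square by (intro abs_mult_le residual_gram_le)
  have int: "integrable (M \<Otimes>\<^sub>M M) (\<lambda>(x, y). (?G x y)\<^sup>2)"
    by (rule integrable_bounded_by) (use bound in \<open>auto simp: square.P.finite_measure_axioms\<close>)
  have bound': "\<bar>?G x y * ?R x y * score x\<bar> \<le> ((1 + radius) * (1 + radius)) * (1 + radius) * 1"
    "\<bar>?G x y * ?R x y * score y\<bar> \<le> ((1 + radius) * (1 + radius)) * (1 + radius) * 1" for x y
    by (intro abs_mult_le residual_gram_le residual_le score_le_1)+
  have 1: "(\<integral>x. \<integral>y. ?G x y * ?R x y * score x \<partial>M \<partial>M) = 0"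
  proof -
    have "(\<integral>x. \<integral>y. ?G x y * ?R x y * score x \<partial>M \<partial>M) = (\<integral>x. 0 \<partial>M)"
      by (intro Bochner_Integration.integral_cong refl) (simp add: residual_cube_diagonal)
    then show ?thesis by simp
  qed
  have 2: "(\<integral>x. \<integral>y. ?G x y * ?R x y * score y \<partial>M \<partial>M) = 0"
  proof -
    have "(\<integral>x. \<integral>y. ?G x y * ?R x y * score y \<partial>M \<partial>M) = (\<integral>y. \<integral>x. ?G x y * ?R x y * score y \<partial>M \<partial>M)"
      by (rule fubini_swap[OF _ bound'(2)]) auto
    also have "\<dots> = (\<integral>y. \<integral>x. - (?G y x * ?R y x * score y) \<partial>M \<partial>M)"
    proof (intro Bochner_Integration.integral_cong refl)
      fix x y
      show "?G x y * ?R x y * score y = - (?G y x * ?R y x * score y)"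
        unfolding residual_gram_sym[of x y] residual_antisym[of x y] by simp
    qed
    finally show ?thesis using 1 by simp
  qed
  have "(\<integral>(x, y). (?G x y)\<^sup>2 \<partial>(M \<Otimes>\<^sub>M M)) = (\<integral>x. \<integral>y. (?G x y)\<^sup>2 \<partial>M \<partial>M)"
    by (rule square.integral_fst[symmetric, OF int])
  also have "\<dots> = (\<integral>x. \<integral>y. ?G x y * ?R x y * score y - ?G x y * ?R x y * score x \<partial>M \<partial>M)"
  proof (rule integral_cong_AE)
    show "AE x in M. (\<integral>y. (?G x y)\<^sup>2 \<partial>M) = (\<integral>y. ?G x y * ?R x y * score y - ?G x y * ?R x y * score x \<partial>M)"
      using residual_equation AE_space
    proof eventually_elim
      case (elim x)
      show ?case
      proof (rule integral_cong_AE)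
        show "AE y in M. (?G x y)\<^sup>2 = ?G x y * ?R x y * score y - ?G x y * ?R x y * score x"
          using elim(1)
        proof eventually_elim
          case (elim y)
          then have "?G x y = - ?R x y * (score x - score y)" by (simp add: residual_gram_def)
          then have "?G x y * ?G x y = ?G x y * (- ?R x y * (score x - score y))" by (rule arg_cong)
          then show ?case by (simp add: power2_eq_square algebra_simps)
        qed
      qed (use elim in auto)
    qed
  qed auto
  also have "\<dots> = (\<integral>x. (\<integral>y. ?G x y * ?R x y * score y \<partial>M) - (\<integral>y. ?G x y * ?R x y * score x \<partial>M) \<partial>M)"
    by (intro Bochner_Integration.integral_cong refl Bochner_Integration.integral_diff
         integrable_bounded_by[OF _ finite_measure_axioms bound'(1)]
         integrable_bounded_by[OF _ finite_measure_axioms bound'(2)]) auto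
  also have "\<dots> = 0"
    using bound' by (subst Bochner_Integration.integral_diff)
      (auto simp: 1 2 intro!: integrable_bounded_by[OF _ finite_measure_axioms abs_integral_le] simp del: integral_mult_left_zero integral_mult_right_zero)
  finally show ?thesis
    using int by (subst (asm) integral_nonneg_eq_0_iff_AE) auto
qed

text \<open>
  For a set \<open>B\<close> let \<open>h\<close> be the residual applied to its indicator. The squared norm of \<open>h\<close> is the
  integral of the Gram kernel over \<open>B \<times> B\<close>, that is, 0. So the residual integrates to 0 over every
  rectangle \<open>A \<times> B\<close>. Passing through rectangles avoids the diagonal of the Gram kernel, about which
  a relation that holds almost everywhere says nothing.
\<close>

lemma residual_eq_0: "AE (x, y) in M \<Otimes>\<^sub>M M. residual x y = 0"
proof -
  let ?G = residual_gram and ?R = residual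
  have G0: "AE x in M. AE y in M. ?G x y = 0"
    using square.AE_pair[OF residual_gram_eq_0] by simp
  have "AE z in M \<Otimes>\<^sub>M M. case_prod ?R z = 0"
  proof (rule square.AE_eq_0_if_rectangle_integrals_0)
    show "integrable (M \<Otimes>\<^sub>M M) (case_prod ?R)"
      by (rule integrable_bounded_by[where C = "1 + radius"])
         (auto intro: residual_le simp: square.P.finite_measure_axioms)
    fix A B assume [measurable]: "A \<in> sets M" "B \<in> sets M"
    have ind: "\<bar>indicator S x :: real\<bar> \<le> 1" for S and x :: 'a by (simp add: indicator_def)
    define h where "h x = (\<integral>y. indicator B y * ?R x y \<partial>M)" for x
    have h_le: "\<bar>h x\<bar> \<le> 1 * (1 + radius)" for x
      unfolding h_def by (intro abs_integral_le abs_mult_le ind residual_le)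
    have [measurable]: "h \<in> borel_measurable M" unfolding h_def by measurable
    have "(\<integral>z. (h z)\<^sup>2 \<partial>M) = (\<integral>z. \<integral>x. indicator B x * ?R z x * h z \<partial>M \<partial>M)"
      by (simp add: power2_eq_square h_def)
    also have "\<dots> = (\<integral>x. \<integral>z. indicator B x * ?R z x * h z \<partial>M \<partial>M)"
      by (intro fubini_swap[where C = "1 * (1 + radius) * (1 * (1 + radius))"]
           abs_mult_le ind residual_le h_le) measurable
    also have "\<dots> = (\<integral>x. 0 \<partial>M)"
    proof (rule integral_cong_AE)
      show "AE x in M. (\<integral>z. indicator B x * ?R z x * h z \<partial>M) = 0"
        using G0 AE_space
      proof eventually_elim
        case (elim x)
        have "(\<integral>z. ?R z x * h z \<partial>M) = (\<integral>z. \<integral>y. indicator B y * ?R z x * ?R z y \<partial>M \<partial>M)"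
          by (simp add: h_def mult.assoc mult.left_commute[of _ "?R _ x"])
        also have "\<dots> = (\<integral>y. \<integral>z. indicator B y * ?R z x * ?R z y \<partial>M \<partial>M)"
          using elim(2) by (intro fubini_swap[where C = "1 * (1 + radius) * (1 + radius)"]
            abs_mult_le ind residual_le) measurable
        also have "\<dots> = (\<integral>y. indicator B y * ?G x y \<partial>M)"
        proof (intro Bochner_Integration.integral_cong refl)
          fix y
          have "indicator B y * ?R z x * ?R z y = indicator B y * (?R x z * ?R y z)" for z
            unfolding residual_antisym[of z x] residual_antisym[of z y] by simp
          then have "(\<integral>z. indicator B y * ?R z x * ?R z y \<partial>M) = (\<integral>z. indicator B y * (?R x z * ?R y z) \<partial>M)"
            by (simp only:)
          then show "(\<integral>z. indicator B y * ?R z x * ?R z y \<partial>M) = indicator B y * ?G x y"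
            by (simp add: residual_gram_def)
        qed
        also have "\<dots> = (\<integral>y. 0 \<partial>M)"
          using elim by (intro integral_cong_AE) auto
        finally show ?case by (simp add: mult.assoc)
      qed
    qed auto
    finally have "(\<integral>z. (h z)\<^sup>2 \<partial>M) = 0" by simp
    moreover have "integrable M (\<lambda>z. (h z)\<^sup>2)"
      unfolding power2_eq_square
      by (intro integrable_bounded_by[OF _ finite_measure_axioms abs_mult_le[OF h_le h_le]]) measurable
    ultimately have "AE z in M. (h z)\<^sup>2 = 0"
      by (subst (asm) integral_nonneg_eq_0_iff_AE) auto
    then have "(\<integral>x. indicator A x * h x \<partial>M) = (\<integral>x. 0 \<partial>M)"
      by (intro integral_cong_AE) auto
    then show "(\<integral>x. indicator A x * (\<integral>y. indicator B y * case_prod ?R (x, y) \<partial>M) \<partial>M) = 0"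
      by (simp add: h_def)
  qed
  then show ?thesis by (simp add: case_prod_beta)
qed

theorem kernel_eq_sgn: "AE (x, y) in M \<Otimes>\<^sub>M M. K x y = radius * sgn (score x - score y)"
  using residual_eq_0 by (simp add: residual_def)

text \<open>Scores are bounded by \<open>1/2\<close>, and a uniform distribution fills its interval.\<close>

lemma radius_le_half: "radius \<le> 1 / 2"
proof (rule ccontr)
  assume "\<not> ?thesis"
  then have r: "1 / 2 < radius" by simp
  then have c: "0 < c" unfolding radius_def
    by (metis not_less real_sqrt_le_0_iff less_trans half_gt_zero zero_less_one order.strict_trans1)
  have "AE t in distr M borel score. t \<in> {..1 / 2}"
    using order_trans[OF abs_ge_self score_le_half]
    by (subst AE_distr_iff) (simp_all del: less_divide_eq_numeral1 le_divide_eq_numeral1)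
  then have "AE t in lborel. t \<in> {- radius..radius} \<longrightarrow> t \<le> 1 / 2"
    unfolding score_uniform[OF c] using r by (subst (asm) AE_uniform_measure) auto
  then have "AE t in lborel. t \<notin> {1 / 2<..radius}"
    by eventually_elim (use r in auto)
  then have "emeasure lborel {t \<in> space lborel. t \<in> {1 / 2<..radius}} = 0"
    by (rule emeasure_eq_0_AE)
  then have "emeasure lborel {1 / 2<..radius} = 0"
    by (simp del: greaterThanAtMost_iff)
  then show False using r by simp
qed

end

section \<open>From the unit square to a product of Borel probability spaces\<close>

text \<open>
  Lebesgue measure on the square is not a product measure but the completion of one, while Fubini's
  theorem concerns product measures. The analysis therefore takes place on this Borel measure. It is a measure on all reals that is concentrated on the
  interval, so that its products need no restriction of the space either.
\<close>

definition unit_measure :: "real measure" where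
  "unit_measure = density lborel (indicator unit_ivl)"

lemma sets_unit_measure [simp, measurable_cong]: "sets unit_measure = sets borel"
  and space_unit_measure [simp]: "space unit_measure = UNIV"
  by (simp_all add: unit_measure_def)

lemma emeasure_unit_measure:
  "A \<in> sets borel \<Longrightarrow> emeasure unit_measure A = emeasure lborel (A \<inter> unit_ivl)"
  by (simp add: unit_measure_def emeasure_density Int_commute flip: indicator_inter_arith)

lemma prob_space_unit_measure: "prob_space unit_measure"
  by (rule prob_spaceI) (simp add: emeasure_unit_measure)

interpretation unit: prob_space unit_measure
  by (rule prob_space_unit_measure)

interpretation unit_square: pair_prob_space unit_measure unit_measure ..

lemma AE_unit_measure: "(AE x in unit_measure. P x) \<longleftrightarrow> (AE x in lborel. x \<in> unit_ivl \<longrightarrow> P x)"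
  unfolding unit_measure_def
  by (subst AE_density) (auto simp: indicator_def intro!: arg_cong[where f = "\<lambda>Q. AE x in lborel. Q x"])

lemma unit_square_lebesgue [simp]: "unit_ivl \<times> unit_ivl \<in> sets lebesgue"
  by (simp add: borel_closed closed_Times)

lemma AE_unit_square:
  "(AE z in lebesgue_on (unit_ivl \<times> unit_ivl). P z) \<longleftrightarrow> (AE z in unit_measure \<Otimes>\<^sub>M unit_measure. P z)"
proof -
  have "unit_measure \<Otimes>\<^sub>M unit_measure
      = density (lborel \<Otimes>\<^sub>M lborel) (\<lambda>(x, y). indicator unit_ivl x * indicator unit_ivl y)"
    unfolding unit_measure_def
    by (rule pair_measure_density)
       (auto simp: lborel.sigma_finite_measure_axioms unit_measure_def[symmetric] unit.sigma_finite_measure_axioms)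
  then have "(AE z in unit_measure \<Otimes>\<^sub>M unit_measure. P z)
      \<longleftrightarrow> (AE z in lborel \<Otimes>\<^sub>M lborel.
            (case z of (x, y) \<Rightarrow> indicator unit_ivl x * indicator unit_ivl y) > (0 :: ennreal) \<longrightarrow> P z)"
    by (simp only:) (rule AE_density, measurable)
  also have "\<dots> \<longleftrightarrow> (AE z in lborel.
            (case z of (x, y) \<Rightarrow> indicator unit_ivl x * indicator unit_ivl y) > (0 :: ennreal) \<longrightarrow> P z)"
    by (simp only: lborel_prod)
  also have "\<dots> \<longleftrightarrow> (AE z in lborel. z \<in> unit_ivl \<times> unit_ivl \<longrightarrow> P z)"
    by (rule AE_cong) (auto split: split_indicator split_indicator_asm)
  also have "\<dots> \<longleftrightarrow> (AE z in lebesgue_on (unit_ivl \<times> unit_ivl). P z)"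
    by (subst AE_restrict_space_iff) (auto simp: AE_completion_iff)
  finally show ?thesis by simp
qed

text \<open>
  Lebesgue measure is complete, so \<open>f\<close> is measurable along with \<open>g\<close>. This makes the integrals in
  \<open>return_density\<close> those of a Borel kernel.
\<close>

lemma integral_lebesgue_on_unit:
  fixes f g :: "real \<Rightarrow> real"
  assumes "AE x in unit_measure. f x = g x" and [measurable]: "g \<in> borel_measurable borel"
  shows "(LINT x|lebesgue_on unit_ivl. f x) = (\<integral>x. g x \<partial>unit_measure)"
proof -
  let ?F = "\<lambda>x. indicator unit_ivl x * f x" and ?G = "\<lambda>x. indicator unit_ivl x * g x"
  have "AE x in lborel. ?G x = ?F x"
    using assms(1) unfolding AE_unit_measure by eventually_elim (auto simp: indicator_def)
  then have ae: "AE x in lebesgue. ?G x = ?F x"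
    by (simp only: AE_completion_iff)
  have G: "?G \<in> borel_measurable lebesgue" by (intro measurable_completion) measurable
  have "(LINT x|lebesgue_on unit_ivl. f x) = (\<integral>x. ?F x \<partial>lebesgue)"
    by (subst integral_restrict_space) auto
  also have "\<dots> = (\<integral>x. ?G x \<partial>lebesgue)"
    using ae G borel_measurable_AE[OF G ae] by (intro integral_cong_AE) auto
  also have "\<dots> = (\<integral>x. ?G x \<partial>lborel)"
    by (rule integral_completion) measurable
  also have "\<dots> = (\<integral>x. g x \<partial>unit_measure)"
  proof -
    have "unit_measure = density lborel (\<lambda>x. ennreal (indicator unit_ivl x))"
      by (simp add: unit_measure_def ennreal_indicator)
    then have "(\<integral>x. g x \<partial>unit_measure)
        = (\<integral>x. g x \<partial>density lborel (\<lambda>x. ennreal (indicator unit_ivl x)))"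
      by (rule arg_cong)
    also have "\<dots> = (\<integral>x. indicator unit_ivl x *\<^sub>R g x \<partial>lborel)"
      by (rule integral_density) auto
    finally show ?thesis by simp
  qed
  finally show ?thesis .
qed

text \<open>
  A Lebesgue measurable function agrees almost everywhere with a Borel function \<open>B\<close>, which need not
  inherit the tournament identity pointwise. Antisymmetrising and clipping restore it everywhere and
  change \<open>B\<close> only on a null set.
\<close>

lemma tournamenton_borel_version:
  assumes "tournamenton W"
  obtains K where "case_prod K \<in> borel_measurable (unit_measure \<Otimes>\<^sub>M unit_measure)"
    "\<And>x y. K x y = - K y x" "\<And>x y. \<bar>K x y\<bar> \<le> 1 / 2"
    "AE (x, y) in unit_measure \<Otimes>\<^sub>M unit_measure. W x y = 1 / 2 + K x y"
proof -
  let ?U = "unit_measure \<Otimes>\<^sub>M unit_measure" and ?S = "unit_ivl \<times> unit_ivl"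
  have W: "\<And>x y. x \<in> unit_ivl \<Longrightarrow> y \<in> unit_ivl \<Longrightarrow> 0 \<le> W x y \<and> W x y + W y x = 1"
    and Wm: "case_prod W \<in> borel_measurable (lebesgue_on ?S)"
    using assms by (auto simp: tournamenton_def)
  have "(\<lambda>z. if z \<in> ?S then case_prod W z else 0) \<in> borel_measurable lebesgue"
    using Wm by (rule borel_measurable_if_I) simp
  then obtain B where B: "B \<in> borel_measurable lborel"
    and WB: "AE z in lborel. (if z \<in> ?S then case_prod W z else 0) = B z"
    using completion_ex_borel_measurable_real by blast
  have [measurable]: "B \<in> borel_measurable (borel \<Otimes>\<^sub>M borel)"
    using B by (simp add: borel_prod)
  define K where "K x y = max (- 1 / 2) (min (1 / 2) ((B (x, y) - B (y, x)) / 2))" for x y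
  have "AE z in lebesgue_on ?S. case_prod W z = B z"
    using WB by (subst AE_restrict_space_iff) (auto simp: AE_completion_iff elim: eventually_mono)
  then have "AE z in ?U. case_prod W z = B z"
    by (simp only: AE_unit_square)
  moreover from this have "AE z in ?U. case_prod W (case z of (x, y) \<Rightarrow> (y, x)) = B (case z of (x, y) \<Rightarrow> (y, x))"
    by (subst (asm) unit_square.distr_pair_swap) (rule AE_distrD[rotated], auto)
  moreover have "AE z in ?U. z \<in> ?S"
    unfolding AE_unit_square[symmetric] by (subst AE_restrict_space_iff) auto
  ultimately have "AE z in ?U. case_prod W z = 1 / 2 + case_prod K z"
  proof eventually_elim
    case (elim z)
    obtain x y where z: "z = (x, y)" by (cases z)
    have "W x y + W y x = 1" "0 \<le> W x y" "0 \<le> W y x"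
      using W[of x y] W[of y x] elim(3) z by auto
    moreover have "W x y = B (x, y)" "W y x = B (y, x)" using elim(1,2) z by auto
    ultimately have "K x y = (W x y - W y x) / 2" "W x y - W y x = 2 * W x y - 1"
      unfolding K_def by (simp_all add: max_def min_def)
    then show ?case unfolding z by simp
  qed
  then have WK: "AE (x, y) in ?U. W x y = 1 / 2 + K x y"
    by (simp add: case_prod_beta)
  have Km: "case_prod K \<in> borel_measurable ?U"
    unfolding K_def by measurable
  have antisym: "K x y = - K y x" for x y
  proof -
    have "max (- 1 / 2) (min (1 / 2) (- t)) = - max (- 1 / 2) (min (1 / 2) t)" for t :: real
      by (auto simp: max_def min_def)
    from this[of "(B (y, x) - B (x, y)) / 2"] show ?thesis
      unfolding K_def minus_divide_left minus_diff_eq .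
  qed
  have bound: "\<bar>K x y\<bar> \<le> 1 / 2" for x y
  proof -
    have "\<bar>max (- 1 / 2) (min (1 / 2) t)\<bar> \<le> 1 / 2" for t :: real
      by (auto simp: max_def min_def)
    then show ?thesis unfolding K_def .
  qed
  show ?thesis by (rule that[OF Km antisym bound WK])
qed

text \<open>
  A Lebesgue measurable set differs from a Borel set by a null set, and the preimage of a null set is
  null because the Borel measure is preserved.
\<close>

lemma measure_preserving_lebesgue_on_unit:
  assumes [measurable]: "\<phi> \<in> borel_measurable borel"
    and range: "\<And>x. \<phi> x \<in> unit_ivl"
    and distr: "distr unit_measure borel \<phi> = unit_measure"
  shows "measure_preserving (lebesgue_on unit_ivl) (lebesgue_on unit_ivl) \<phi>"
proof -
  have *: "\<phi> -` A \<inter> unit_ivl \<in> sets lebesgue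
      \<and> emeasure lebesgue (\<phi> -` A \<inter> unit_ivl) = emeasure lebesgue (A \<inter> unit_ivl)"
    if A: "A \<in> sets lebesgue" for A
  proof -
    define B where "B = main_part lborel A"
    have B [measurable]: "B \<in> sets borel" unfolding B_def using main_part_sets[OF A] by simp
    have AB: "AE t in lborel. t \<in> B \<longleftrightarrow> t \<in> A"
      using AE_in_main_part[OF A] by (simp add: B_def)
    then have "AE t in distr unit_measure borel \<phi>. t \<in> B \<longleftrightarrow> t \<in> A"
      unfolding distr AE_unit_measure by eventually_elim simp
    then have "AE x in unit_measure. \<phi> x \<in> B \<longleftrightarrow> \<phi> x \<in> A"
      by (rule AE_distrD[rotated]) simp
    then have ae: "AE x in lebesgue. x \<in> \<phi> -` B \<inter> unit_ivl \<longleftrightarrow> x \<in> \<phi> -` A \<inter> unit_ivl"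
      unfolding AE_unit_measure AE_completion_iff by eventually_elim auto
    have Bm: "\<phi> -` B \<inter> unit_ivl \<in> sets borel"
      using measurable_sets[OF assms(1) B] by simp
    have Am: "\<phi> -` A \<inter> unit_ivl \<in> sets lebesgue"
      using Bm by (intro completion.in_sets_AE[OF ae]) auto
    have "emeasure lebesgue (\<phi> -` A \<inter> unit_ivl) = emeasure lebesgue (\<phi> -` B \<inter> unit_ivl)"
      using ae Am Bm by (intro emeasure_eq_AE) auto
    also have "\<dots> = emeasure unit_measure (\<phi> -` B)"
      using Bm measurable_sets[OF assms(1) B] by (simp add: emeasure_unit_measure)
    also have "\<dots> = emeasure (distr unit_measure borel \<phi>) B"
      by (subst emeasure_distr) auto
    also have "\<dots> = emeasure lebesgue (B \<inter> unit_ivl)"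
      unfolding distr by (simp add: emeasure_unit_measure)
    also have "\<dots> = emeasure lebesgue (A \<inter> unit_ivl)"
      using AB A B by (intro emeasure_eq_AE) (auto simp: AE_completion_iff)
    finally show ?thesis using Am by simp
  qed
  show ?thesis
    unfolding measure_preserving_def
  proof (intro conjI ballI)
    show "\<phi> \<in> measurable (lebesgue_on unit_ivl) (lebesgue_on unit_ivl)"
    proof (rule measurable_restrict_space2)
      show "\<phi> \<in> measurable (lebesgue_on unit_ivl) lebesgue"
        using * by (intro measurableI) (auto simp: sets_restrict_space_iff)
    qed (use range in auto)
    fix A assume "A \<in> sets (lebesgue_on unit_ivl)"
    then have A: "A \<in> sets lebesgue" "A \<subseteq> unit_ivl"
      by (auto simp: sets_restrict_space_iff)
    then show "emeasure (lebesgue_on unit_ivl) (\<phi> -` A \<inter> space (lebesgue_on unit_ivl))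
        = emeasure (lebesgue_on unit_ivl) A"
      using *[OF A(1)] by (subst (1 2) emeasure_restrict_space) (auto simp: Int_absorb2)
  qed
qed

text \<open>
  The affine map from \<open>[-r, r]\<close> onto \<open>[0, 1]\<close> that reverses the order: in the Condorcet tournamenton the
  smaller argument is the stronger one. Scores lie in \<open>[-r, r]\<close> only almost surely, so the values
  are clipped to the unit interval.
\<close>

definition rank :: "real \<Rightarrow> real \<Rightarrow> real" where
  "rank r t = max 0 (min 1 (1 / 2 - t / (2 * r)))"

lemma distr_rank_uniform:
  assumes r: "0 < r"
  shows "distr (uniform_measure lborel {- r..r}) borel (rank r) = unit_measure"
proof (rule measure_eqI)
  fix A assume "A \<in> sets (distr (uniform_measure lborel {- r..r}) borel (rank r))"
  then have A [measurable]: "A \<in> sets borel" by simp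
  have [measurable]: "rank r \<in> borel_measurable borel" unfolding rank_def by measurable
  have "emeasure unit_measure A = (\<integral>\<^sup>+ t. indicator (A \<inter> unit_ivl) t \<partial>lborel)"
    by (simp add: emeasure_unit_measure)
  also have "\<dots> = ennreal \<bar>- 1 / (2 * r)\<bar> * (\<integral>\<^sup>+ t. indicator (A \<inter> unit_ivl) (1 / 2 + (- 1 / (2 * r)) * t) \<partial>lborel)"
    using r by (intro nn_integral_real_affine) auto
  also have "\<dots> = ennreal (1 / (2 * r)) * (\<integral>\<^sup>+ t. indicator ({- r..r} \<inter> rank r -` A) t \<partial>lborel)"
    using r by (intro arg_cong2[where f = times] nn_integral_cong arg_cong[where f = ennreal])
      (auto simp: indicator_def rank_def field_simps)
  also have "\<dots> = ennreal (1 / (2 * r)) * emeasure lborel ({- r..r} \<inter> rank r -` A)"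
    using measurable_sets[of "rank r" borel borel A] by simp
  also have "\<dots> = emeasure lborel ({- r..r} \<inter> rank r -` A) / emeasure lborel {- r..r}"
  proof -
    have "emeasure lborel {- r..r} = ennreal (2 * r)" using r by simp
    moreover have "inverse (ennreal (2 * r)) = ennreal (1 / (2 * r))"
      using r by (simp add: inverse_ennreal inverse_eq_divide)
    ultimately show ?thesis by (simp only: divide_ennreal_def mult.commute)
  qed
  also have "\<dots> = emeasure (uniform_measure lborel {- r..r}) (rank r -` A)"
    using measurable_sets[of "rank r" borel borel A] by (intro emeasure_uniform_measure[symmetric]) auto
  also have "\<dots> = emeasure (distr (uniform_measure lborel {- r..r}) borel (rank r)) A"
    by (subst emeasure_distr) auto
  finally show "emeasure (distr (uniform_measure lborel {- r..r}) borel (rank r)) A = emeasure unit_measure A" ..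
qed simp

lemma condorcet_eq_sgn: "condorcet (1 / 2 + r) x y = 1 / 2 + r * sgn (y - x)"
  by (auto simp: condorcet_def sgn_if)

lemma return_density_eq:
  assumes "case_prod K \<in> borel_measurable (unit_measure \<Otimes>\<^sub>M unit_measure)"
    and K: "\<And>x y. K x y = - K y x" "\<And>x y. \<bar>K x y\<bar> \<le> 1 / 2"
    and W: "AE z in unit_measure. W y z = 1 / 2 + K y z" "AE z in unit_measure. W z x = 1 / 2 + K z x"
  shows "return_density W x y = 1 / 4 + ((\<integral>z. K y z \<partial>unit_measure) - (\<integral>z. K x z \<partial>unit_measure)) / 2
     - (\<integral>z. K x z * K y z \<partial>unit_measure)"
proof -
  have [measurable]: "K x \<in> borel_measurable borel" for x
    using measurable_Pair2[OF assms(1), of x] by simp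
  have int: "integrable unit_measure (K x)" "integrable unit_measure (\<lambda>z. K x z * K y z)" for x y
  proof -
    have "\<bar>K x y\<bar> \<le> 1" for x y using K(2)[of x y] by linarith
    then show "integrable unit_measure (K x)" "integrable unit_measure (\<lambda>z. K x z * K y z)"
      by (auto intro!: unit.integrable_const_bound[where B = 1] simp: abs_mult mult_le_one)
  qed
  have "return_density W x y = (\<integral>z. (1 / 2 + K y z) * (1 / 2 - K x z) \<partial>unit_measure)"
    unfolding return_density_def
  proof (rule integral_lebesgue_on_unit)
    show "AE z in unit_measure. W y z * W z x = (1 / 2 + K y z) * (1 / 2 - K x z)"
      using W by eventually_elim (simp add: K(1)[of _ x])
  qed measurable
  also have "\<dots> = (\<integral>z. 1 / 4 + (1 / 2 * K y z - 1 / 2 * K x z) - K x z * K y z \<partial>unit_measure)"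
    by (intro Bochner_Integration.integral_cong refl) (simp add: algebra_simps)
  also have "\<dots> = 1 / 4 + (1 / 2 * (\<integral>z. K y z \<partial>unit_measure) - 1 / 2 * (\<integral>z. K x z \<partial>unit_measure))
      - (\<integral>z. K x z * K y z \<partial>unit_measure)"
    using int unit.prob_space by simp
  finally show ?thesis by (simp add: diff_divide_distrib)
qed

text \<open>
  With \<open>W = 1/2 + K\<close>, the two return densities of \<open>return_density_eq\<close> differ only in the sign of the
  score difference. Weighted by \<open>1/2 + K x y\<close> and \<open>1/2 - K x y\<close>, they add up to \<open>1/4\<close> minus the left
  side of the coregularity relation.
\<close>

lemma triangle_coregular_kernel:
  assumes "tournamenton W" and "triangle_coregular W"
  obtains K c where "coregular_kernel unit_measure K c"
    "AE (x, y) in unit_measure \<Otimes>\<^sub>M unit_measure. W x y = 1 / 2 + K x y"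
proof -
  let ?U = "unit_measure \<Otimes>\<^sub>M unit_measure"
  obtain K where Km [measurable]: "case_prod K \<in> borel_measurable ?U"
    and K: "\<And>x y. K x y = - K y x" "\<And>x y. \<bar>K x y\<bar> \<le> 1 / 2"
    and WK: "AE (x, y) in ?U. W x y = 1 / 2 + K x y"
    using tournamenton_borel_version[OF assms(1)] by blast
  obtain c' where "AE (x, y) in ?U. triangle_codegree W x y = c'"
    using assms(2) unfolding triangle_coregular_def AE_unit_square by blast
  then have c': "AE x in unit_measure. AE y in unit_measure. triangle_codegree W x y = c'"
    using unit_square.AE_pair by fastforce
  define c where "c = 1 / 4 - 2 * c'"
  let ?d = "\<lambda>x. \<integral>z. K x z \<partial>unit_measure"
  have out: "AE x in unit_measure. AE z in unit_measure. W x z = 1 / 2 + K x z"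
    using unit_square.AE_pair[OF WK] by simp
  have I: "AE x in unit_measure. x \<in> unit_ivl" by (simp add: AE_unit_measure)
  \<comment> \<open>The tournament identity turns columns into rows, but only at points of the interval.\<close>
  have "in": "AE x in unit_measure. AE z in unit_measure. W z x = 1 / 2 + K z x"
    using out I
  proof eventually_elim
    case (elim x)
    show ?case
      using elim(1) I
    proof eventually_elim
      case (elim z)
      have "W x z + W z x = 1"
        using assms(1) \<open>x \<in> unit_ivl\<close> elim(2) by (auto simp: tournamenton_def)
      then show ?case using elim(1) K(1)[of x z] by simp
    qed
  qed
  have cor: "AE x in unit_measure. AE y in unit_measure.
      (\<integral>z. K x z * K y z \<partial>unit_measure) + K x y * (?d x - ?d y) = c"
    using c' out "in"
  proof eventually_elim
    case x: (elim x)
    show ?case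
      using x(1,2,3) out "in"
    proof eventually_elim
      case y: (elim y)
      let ?g = "\<integral>z. K x z * K y z \<partial>unit_measure"
      have "return_density W x y = 1 / 4 + (?d y - ?d x) / 2 - ?g"
        by (rule return_density_eq[OF Km K y(4) x(3)])
      moreover have "return_density W y x = 1 / 4 + (?d x - ?d y) / 2 - ?g"
        using return_density_eq[OF Km K x(2) y(5)] by (simp add: mult.commute)
      moreover have "W y x = 1 / 2 - K x y" using y(3) K(1)[of y x] by simp
      ultimately have "((1 / 2 + K x y) * (1 / 4 + (?d y - ?d x) / 2 - ?g)
          + (1 / 2 - K x y) * (1 / 4 + (?d x - ?d y) / 2 - ?g)) / 2 = c'"
        using y(1,2) unfolding triangle_codegree_def by simp
      then show ?case unfolding c_def by (simp add: field_simps)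
    qed
  qed
  have "coregular_kernel unit_measure K c"
    by unfold_locales (fact Km K cor)+
  then show ?thesis using WK by (rule that)
qed

text \<open>The order of the points by score is the Condorcet order; the map on the side of \<open>W\<close> is the identity.\<close>

lemma weakly_equivalent_condorcet:
  assumes "coregular_kernel unit_measure K c"
    and WK: "AE (x, y) in unit_measure \<Otimes>\<^sub>M unit_measure. W x y = 1 / 2 + K x y"
  shows "weakly_equivalent W (condorcet (1 / 2 + coregular_kernel.radius c))"
proof -
  interpret coregular_kernel unit_measure K c by fact
  let ?U = "unit_measure \<Otimes>\<^sub>M unit_measure"
  \<comment> \<open>For \<open>c = 0\<close> both tournamentons are almost everywhere \<open>1/2\<close> and the scores carry no information, so the identity
    of the interval is used, clipped outside of it.\<close>
  define \<phi> where "\<phi> = (if c = 0 then \<lambda>x. max 0 (min 1 x) else rank radius \<circ> score)"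
  have [measurable]: "rank radius \<in> borel_measurable borel" unfolding rank_def by measurable
  have \<phi>_measurable [measurable]: "\<phi> \<in> borel_measurable borel"
    using measurable_score by (auto simp: \<phi>_def comp_def)
  have "distr unit_measure borel \<phi> = unit_measure"
  proof (cases "c = 0")
    case True
    then have "distr unit_measure borel \<phi> = distr unit_measure borel (\<lambda>x. x)"
      by (intro distr_cong_AE) (auto simp: \<phi>_def AE_unit_measure)
    then show ?thesis by (simp add: distr_id2)
  next
    case False
    then have c: "0 < c" using c_nonneg by simp
    then have r: "0 < radius" by (simp add: radius_def)
    have "distr unit_measure borel \<phi> = distr (distr unit_measure borel score) borel (rank radius)"
      using False by (simp add: \<phi>_def distr_distr)
    then show ?thesis
      unfolding score_uniform[OF c] distr_rank_uniform[OF r] .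
  qed
  then have "measure_preserving (lebesgue_on unit_ivl) (lebesgue_on unit_ivl) \<phi>"
    by (intro measure_preserving_lebesgue_on_unit) (auto simp: \<phi>_def rank_def)
  moreover have "measure_preserving (lebesgue_on unit_ivl) (lebesgue_on unit_ivl) (\<lambda>x. x)"
    using sets.sets_into_space[of _ "lebesgue_on unit_ivl"]
    by (auto simp: measure_preserving_def Int_absorb2)
  moreover have "AE (x, y) in ?U. W x y = condorcet (1 / 2 + radius) (\<phi> x) (\<phi> y)"
  proof -
    have "AE z in ?U. score (fst z) \<in> {- radius..radius} \<and> score (snd z) \<in> {- radius..radius}"
    proof (rule unit_square.AE_pair_measure)
      show "AE x in unit_measure. AE y in unit_measure.
        score (fst (x, y)) \<in> {- radius..radius} \<and> score (snd (x, y)) \<in> {- radius..radius}"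
        using AE_score_le_radius
      proof eventually_elim
        case (elim x)
        show ?case using AE_score_le_radius by eventually_elim (use elim in simp)
      qed
    qed measurable
    with WK kernel_eq_sgn show ?thesis
    proof eventually_elim
      case (elim z)
      obtain x y where z: "z = (x, y)" by (cases z)
      have "radius * sgn (score x - score y) = radius * sgn (\<phi> y - \<phi> x)"
      proof (cases "c = 0")
        case True
        have "radius = 0" unfolding radius_def using True by simp
        then show ?thesis by simp
      next
        case False
        then have r: "0 < radius" using c_nonneg by (simp add: radius_def)
        have "\<phi> w = 1 / 2 - score w / (2 * radius)" if "score w \<in> {- radius..radius}" for w
          using that r False by (simp add: \<phi>_def rank_def max_def min_def field_simps)
        then have "\<phi> y - \<phi> x = (score x - score y) / (2 * radius)"
          using elim(3) z by (simp add: diff_divide_distrib)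
        then show ?thesis using r by (simp add: sgn_divide)
      qed
      then show ?case using elim(1,2) z by (simp add: condorcet_eq_sgn)
    qed
  qed
  ultimately show ?thesis
    unfolding weakly_equivalent_def AE_unit_square by blast
qed

theorem theorem2p9:
  fixes W :: "real \<Rightarrow> real \<Rightarrow> real"
  assumes "tournamenton W"
    and "triangle_coregular W"
  shows "\<exists>p\<in>{1/2..1}. weakly_equivalent W (condorcet p)"
proof -
  obtain K c where kernel: "coregular_kernel unit_measure K c"
    and WK: "AE (x, y) in unit_measure \<Otimes>\<^sub>M unit_measure. W x y = 1 / 2 + K x y"
    using triangle_coregular_kernel[OF assms] by blast
  interpret coregular_kernel unit_measure K c by (fact kernel)
  have "1 / 2 + radius \<in> {1/2..1}"
    using radius_nonneg radius_le_half by simp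
  then show ?thesis
    using weakly_equivalent_condorcet[OF kernel WK] by blast
qed

end
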